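(* Let $D$ be an open set in $\mathbb{C}$. For any $f\in\mathcal{O}(D\times D)$, $$T(Pf)(z,t)=-\left(t\frac{\partial}{\partial t}\right)\left(t\frac{\partial}{\partial t}+1\right)Tf(z,t)\qquad\text{for all }(z,t)\in U_D .$$
   Context: $\mathcal{O}(\cdot)$ denotes the space of holomorphic functions. $P$ is the differential operator on $\mathbb{C}^2$ $$P:=(\zeta_1-\zeta_2)^2\frac{\partial^2}{\partial\zeta_1\partial\zeta_2}-(\zeta_1-\zeta_2)\left(\frac{\partial}{\partial\zeta_1}-\frac{\partial}{\partial\zeta_2}\right).$$ For an open set $D\subset\mathbb{C}$ and $z\in D$, $d(z,\partial D)$ is the distance from $z$ to the boundary of $D$ ($=\infty$ if $D=\mathbb{C}$), and $U_D:=\{(z,t)\in D\times\mathbb{C}:\ 2|t|<d(z,\partial D)\}$. For $f\in\mathcal{O}(D\times D)$ and $(z,t)\in U_D$ define $$(Tf)(z,t):=\frac{1}{(2\pi\sqrt{-1})^2}\oint_{C_1}\oint_{C_2}\frac{f(\zeta_1,\zeta_2)}{(\zeta_1-z)(\zeta_2-z)+t(\zeta_1-\zeta_2)}\,d\zeta_1\,d\zeta_2,$$ where $C_1=C_2$ is the positively oriented circle centred at $z$ of radius $r$ with $2|t|<r<d(z,\partial D)$ (the denominator does not vanish on $C_1\times C_2$, the value does not depend on $r$, and $Tf$ is holomorphic on $U_D$). *)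

theory Defs
  imports "HOL-Complex_Analysis.Complex_Analysis"
begin

text \<open>
  Functions on subsets of \<open>\<complex>\<^sup>2\<close> are total functions on \<open>complex \<times> complex\<close>; all operators below
  are local, so values outside the relevant open set play no role.
\<close>

text \<open>
  Complex Frechet differentiability at every point of \<open>S\<close> (meant for open \<open>S\<close>): the
  \<open>\<complex>\<close>-linear maps \<open>\<complex>\<^sup>2 \<rightarrow> \<complex>\<close> are exactly those of the form \<open>(h, k) \<mapsto> a h + b k\<close>.
\<close>
definition holomorphic2_on :: "(complex \<times> complex \<Rightarrow> complex) \<Rightarrow> (complex \<times> complex) set \<Rightarrow> bool"
  (infixl "holomorphic2'_on" 50) where
  "f holomorphic2_on S \<longleftrightarrow>
     (\<forall>p\<in>S. \<exists>a b. (f has_derivative (\<lambda>(h, k). a * h + b * k)) (at p))"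

definition pd1 :: "(complex \<times> complex \<Rightarrow> complex) \<Rightarrow> complex \<times> complex \<Rightarrow> complex" where
  "pd1 f = (\<lambda>(x, y). deriv (\<lambda>w. f (w, y)) x)"

definition pd2 :: "(complex \<times> complex \<Rightarrow> complex) \<Rightarrow> complex \<times> complex \<Rightarrow> complex" where
  "pd2 f = (\<lambda>(x, y). deriv (\<lambda>w. f (x, w)) y)"

definition P_op :: "(complex \<times> complex \<Rightarrow> complex) \<Rightarrow> complex \<times> complex \<Rightarrow> complex" where
  "P_op f = (\<lambda>(x, y). (x - y)\<^sup>2 * pd1 (pd2 f) (x, y) - (x - y) * (pd1 f (x, y) - pd2 f (x, y)))"

text \<open>
  An extended real, because the infimum over the empty boundary (\<open>D = \<complex>\<close>) must be \<open>\<infinity>\<close>;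
  \<^const>\<open>infdist\<close> would return \<open>0\<close> there.
\<close>
definition bdry_dist :: "complex set \<Rightarrow> complex \<Rightarrow> ereal" where
  "bdry_dist D z = (INF w\<in>frontier D. ereal (dist z w))"

definition U_dom :: "complex set \<Rightarrow> (complex \<times> complex) set" where
  "U_dom D = {(z, t). z \<in> D \<and> ereal (2 * cmod t) < bdry_dist D z}"

definition T_circ :: "(complex \<times> complex \<Rightarrow> complex) \<Rightarrow> real \<Rightarrow> complex \<times> complex \<Rightarrow> complex" where
  "T_circ f r = (\<lambda>(z, t).
     1 / (2 * of_real pi * \<i>)\<^sup>2 *
     contour_integral (circlepath z r) (\<lambda>x.
       contour_integral (circlepath z r) (\<lambda>y.
         f (x, y) / ((x - z) * (y - z) + t * (x - y)))))"

text \<open>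
  For \<open>f\<close> holomorphic on \<open>D \<times> D\<close> and \<open>(z, t) \<in> U_dom D\<close> the value does not depend on the
  admissible radius, so an arbitrary one is chosen, separately at each point \<open>(z, t)\<close>.
\<close>
definition T_op :: "complex set \<Rightarrow> (complex \<times> complex \<Rightarrow> complex) \<Rightarrow> complex \<times> complex \<Rightarrow> complex" where
  "T_op D f = (\<lambda>(z, t).
     T_circ f (SOME r. 2 * cmod t < r \<and> ereal r < bdry_dist D z) (z, t))"

definition euler_t :: "(complex \<times> complex \<Rightarrow> complex) \<Rightarrow> complex \<times> complex \<Rightarrow> complex" where
  "euler_t F = (\<lambda>(z, t). t * pd2 F (z, t))"

end

theory Submission
  imports Defs
begin

text \<open>
  Let \<open>k = 1/Q\<close> with \<open>Q = (x - z)(y - z) + t(x - y)\<close>. Integrating by parts on the torus moves \<open>P\<close>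
  from \<open>f\<close> to the kernel: \<open>(P f) k = \<partial>A/\<partial>x + \<partial>B/\<partial>y + 2t(x - y)(x - z)(y - z) k\<^sup>3 f\<close> for suitable
  \<open>A\<close> and \<open>B\<close>, and the first two terms integrate to zero over closed curves. The last factor
  is \<open>-(t\<partial>\<^sub>t)(t\<partial>\<^sub>t + 1) k\<close>. Since the radius used by \<^const>\<open>T_op\<close> may
  jump with \<open>t\<close>, differentiation under the integral needs independence of the radius; this
  follows by moving one circle at a time, with Fubini in between, since \<open>Q \<noteq> 0\<close> as soon as
  \<open>|x - z|\<close> and \<open>|y - z|\<close> both exceed \<open>2|t|\<close>.
\<close>

section \<open>Circle integrals depending on a parameter\<close>

text \<open>Pulling back to \<open>{0..1}\<close> gives an ordinary integral of a jointly continuous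
  integrand over a compact interval. The parameter space is left general because pairs of complex
  numbers serve as parameters below.\<close>

lemma continuous_on_contour_integral_circlepath:
  fixes G :: "'a::topological_space \<Rightarrow> complex \<Rightarrow> complex"
  assumes "continuous_on (U \<times> sphere z r) (\<lambda>(u, w). G u w)" and "0 \<le> r"
  shows "continuous_on U (\<lambda>u. contour_integral (circlepath z r) (G u))"
proof -
  have "continuous_on (U \<times> {0..1}) (\<lambda>(u, s). G u (circlepath z r s) * vector_derivative (circlepath z r) (at s))"
    unfolding vector_derivative_circlepath split_beta
  proof (intro continuous_intros)
    have "continuous_on (U \<times> {0..1}) (\<lambda>p. (\<lambda>(u, w). G u w) (fst p, circlepath z r (snd p)))"
    proof (rule continuous_on_compose2[OF assms(1)])
      show "continuous_on (U \<times> {0..1}) (\<lambda>p. (fst p, circlepath z r (snd p)))"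
        unfolding circlepath by (intro continuous_intros)
      have "circlepath z r s \<in> sphere z r" if "s \<in> {0..1}" for s
        using that path_image_circlepath_nonneg[OF assms(2), of z] unfolding path_image_def by blast
      then show "(\<lambda>p. (fst p, circlepath z r (snd p))) ` (U \<times> {0..1}) \<subseteq> U \<times> sphere z r"
        by auto
    qed
    then show "continuous_on (U \<times> {0..1}) (\<lambda>p. G (fst p) (circlepath z r (snd p)))"
      by simp
  qed
  then show ?thesis
    unfolding contour_integral_integral box_real(2)[symmetric]
    by (intro integral_continuous_on_param) simp
qed

lemma has_field_derivative_contour_integral_circlepath:
  fixes G :: "complex \<Rightarrow> complex \<Rightarrow> complex"
  assumes "open U" "u \<in> U" "0 \<le> r"
    and der: "\<And>u w. u \<in> U \<Longrightarrow> w \<in> sphere z r \<Longrightarrow> ((\<lambda>u. G u w) has_field_derivative G' u w) (at u)"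
    and cont: "\<And>u. u \<in> U \<Longrightarrow> continuous_on (sphere z r) (G u)"
    and cont': "continuous_on (U \<times> sphere z r) (\<lambda>(u, w). G' u w)"
  shows "((\<lambda>u. contour_integral (circlepath z r) (G u)) has_field_derivative
           contour_integral (circlepath z r) (G' u)) (at u)"
proof -
  \<comment> \<open>The Leibniz rule for integrals wants a convex parameter set. A ball around
    \<open>u\<close> provides one, and being open it gives the derivative at \<open>u\<close>
    itself.\<close>
  obtain e where e: "0 < e" "ball u e \<subseteq> U"
    using assms(1,2) open_contains_ball by blast
  have sph: "circlepath z r s \<in> sphere z r" if "s \<in> {0..1}" for s
    using that path_image_circlepath_nonneg[OF assms(3), of z] unfolding path_image_def by blast
  let ?d = "\<lambda>s. vector_derivative (circlepath z r) (at s)"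
  have "((\<lambda>u. integral (cbox 0 1) (\<lambda>s. G u (circlepath z r s) * ?d s)) has_field_derivative
         integral (cbox 0 1) (\<lambda>s. G' u (circlepath z r s) * ?d s)) (at u within ball u e)"
  proof (rule leibniz_rule_field_derivative)
    show "((\<lambda>u. G u (circlepath z r s) * ?d s) has_field_derivative G' v (circlepath z r s) * ?d s)
            (at v within ball u e)" if "v \<in> ball u e" "s \<in> cbox 0 1" for v s
      by (intro DERIV_cmult_right has_field_derivative_at_within[OF der])
        (use sph[of s] that e(2) in auto)
    show "(\<lambda>s. G v (circlepath z r s) * ?d s) integrable_on cbox 0 1" if "v \<in> ball u e" for v
    proof -
      have "G v contour_integrable_on circlepath z r"
        using cont[of v] that e(2) assms(3)
        by (intro contour_integrable_continuous_circlepath) auto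
      then show ?thesis by (simp add: contour_integrable_on)
    qed
    show "continuous_on (ball u e \<times> cbox 0 1) (\<lambda>(v, s). G' v (circlepath z r s) * ?d s)"
      unfolding vector_derivative_circlepath split_beta
    proof (intro continuous_intros)
      have "continuous_on (ball u e \<times> cbox 0 1) (\<lambda>p. (\<lambda>(u, w). G' u w) (fst p, circlepath z r (snd p)))"
      proof (rule continuous_on_compose2[OF cont'])
        show "continuous_on (ball u e \<times> cbox 0 1) (\<lambda>p. (fst p, circlepath z r (snd p)))"
          unfolding circlepath by (intro continuous_intros)
        show "(\<lambda>p. (fst p, circlepath z r (snd p))) ` (ball u e \<times> cbox 0 1) \<subseteq> U \<times> sphere z r"
          using sph e(2) by auto
      qed
      then show "continuous_on (ball u e \<times> cbox 0 1) (\<lambda>p. G' (fst p) (circlepath z r (snd p)))"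
        by simp
    qed
  qed (use e in auto)
  then show ?thesis
    unfolding contour_integral_integral using at_within_open[of u "ball u e"] e(1) by simp
qed

section \<open>Partial derivatives of holomorphic functions of two variables\<close>

lemma holomorphic2_on_imp_continuous_on:
  "f holomorphic2_on S \<Longrightarrow> continuous_on S f"
  unfolding holomorphic2_on_def
  by (meson continuous_at_imp_continuous_on has_derivative_continuous)

lemma holomorphic2_on_imp_fst_holomorphic:
  assumes "f holomorphic2_on (A \<times> B)" "y \<in> B"
  shows "(\<lambda>x. f (x, y)) holomorphic_on A"
  unfolding holomorphic_on_def
proof
  fix x assume "x \<in> A"
  then obtain a b where "(f has_derivative (\<lambda>(h, k). a * h + b * k)) (at (x, y))"
    using assms unfolding holomorphic2_on_def by blast
  moreover have "((\<lambda>x. (x, y)) has_derivative (\<lambda>h. (h, 0))) (at x)"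
    by (auto intro!: derivative_eq_intros)
  ultimately have "((\<lambda>x. f (x, y)) has_derivative (\<lambda>h. (\<lambda>(h, k). a * h + b * k) (h, 0))) (at x)"
    by (metis has_derivative_compose)
  then have "((\<lambda>x. f (x, y)) has_field_derivative a) (at x)"
    by (simp add: has_field_derivative_def)
  then show "(\<lambda>x. f (x, y)) field_differentiable at x within A"
    using field_differentiable_def field_differentiable_at_within by blast
qed

lemma holomorphic2_on_imp_snd_holomorphic:
  assumes "f holomorphic2_on (A \<times> B)" "x \<in> A"
  shows "(\<lambda>y. f (x, y)) holomorphic_on B"
  unfolding holomorphic_on_def
proof
  fix y assume "y \<in> B"
  then obtain a b where "(f has_derivative (\<lambda>(h, k). a * h + b * k)) (at (x, y))"
    using assms unfolding holomorphic2_on_def by blast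
  moreover have "((\<lambda>y. (x, y)) has_derivative (\<lambda>h. (0, h))) (at y)"
    by (auto intro!: derivative_eq_intros)
  ultimately have "((\<lambda>y. f (x, y)) has_derivative (\<lambda>h. (\<lambda>(h, k). a * h + b * k) (0, h))) (at y)"
    by (metis has_derivative_compose)
  then have "((\<lambda>y. f (x, y)) has_field_derivative b) (at y)"
    by (simp add: has_field_derivative_def)
  then show "(\<lambda>y. f (x, y)) field_differentiable at y within B"
    using field_differentiable_def field_differentiable_at_within by blast
qed

lemma pd1_has_field_derivative:
  assumes "open A" "x \<in> A" "(\<lambda>x. F (x, y)) holomorphic_on A"
  shows "((\<lambda>x. F (x, y)) has_field_derivative pd1 F (x, y)) (at x)"
  unfolding pd1_def using holomorphic_derivI[OF assms(3,1,2)] by simp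

lemma pd2_has_field_derivative:
  assumes "open B" "y \<in> B" "(\<lambda>y. F (x, y)) holomorphic_on B"
  shows "((\<lambda>y. F (x, y)) has_field_derivative pd2 F (x, y)) (at y)"
  unfolding pd2_def using holomorphic_derivI[OF assms(3,1,2)] by simp

text \<open>Cauchy's formula for the derivative. One fixed circle serves every \<open>y\<close> in
  the ball, so \<open>pd2 F\<close> becomes a circle integral depending on parameters, to which the
  preceding section applies.\<close>

lemma pd2_eq_contour_integral:
  assumes hol: "(\<lambda>y. F (x, y)) holomorphic_on B" and r: "cball c r \<subseteq> B" "y \<in> ball c r"
  shows "pd2 F (x, y) =
    1 / (2 * of_real pi * \<i>) * contour_integral (circlepath c r) (\<lambda>w. F (x, w) / (w - y)\<^sup>2)"
proof -
  have "continuous_on (cball c r) (\<lambda>y. F (x, y))" "(\<lambda>y. F (x, y)) holomorphic_on ball c r"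
    using hol r(1) holomorphic_on_imp_continuous_on holomorphic_on_subset ball_subset_cball
    by (metis continuous_on_subset, metis order_trans)
  from Cauchy_derivative_integral_circlepath(2)[OF this r(2)] show ?thesis
    unfolding pd2_def by (simp add: DERIV_imp_deriv)
qed

text \<open>Near each point the Cauchy integral over a fixed circle in the second variable has a
  jointly continuous integrand, since \<open>w - y\<close> stays away from 0 on the circle.\<close>

lemma continuous_on_pd2:
  assumes "open A" "open B" and cont: "continuous_on (A \<times> B) F"
    and hol: "\<And>x. x \<in> A \<Longrightarrow> (\<lambda>y. F (x, y)) holomorphic_on B"
  shows "continuous_on (A \<times> B) (pd2 F)"
proof (rule continuous_at_imp_continuous_on, safe)
  fix x y assume "x \<in> A" "y \<in> B"
  obtain r where r: "0 < r" "cball y r \<subseteq> B"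
    using \<open>y \<in> B\<close> \<open>open B\<close> open_contains_cball by blast
  have "continuous_on (A \<times> ball y r)
          (\<lambda>p. contour_integral (circlepath y r) (\<lambda>w. F (fst p, w) / (w - snd p)\<^sup>2))"
  proof (rule continuous_on_contour_integral_circlepath)
    have "continuous_on ((A \<times> ball y r) \<times> sphere y r) (\<lambda>q. F (fst (fst q), snd q))"
      by (rule continuous_on_compose2[OF cont]) (use r in \<open>auto intro!: continuous_intros\<close>)
    then show "continuous_on ((A \<times> ball y r) \<times> sphere y r) (\<lambda>(p, w). F (fst p, w) / (w - snd p)\<^sup>2)"
      unfolding split_beta by (intro continuous_intros) auto
  qed (use r in simp)
  then have "continuous_on (A \<times> ball y r) (\<lambda>p. 1 / (2 * of_real pi * \<i>) *
      contour_integral (circlepath y r) (\<lambda>w. F (fst p, w) / (w - snd p)\<^sup>2))"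
    by (intro continuous_intros)
  then have "continuous_on (A \<times> ball y r) (pd2 F)"
    by (rule continuous_on_eq) (use pd2_eq_contour_integral[OF hol r(2)] in auto)
  then show "isCont (pd2 F) (x, y)"
    using \<open>x \<in> A\<close> r(1) \<open>open A\<close>
    by (simp add: continuous_on_eq_continuous_at open_Times)
qed

text \<open>Transfers continuity from \<open>pd2\<close> to \<open>pd1\<close> by exchanging the
  coordinates.\<close>

lemma pd1_conv_pd2: "pd1 F = (\<lambda>p. pd2 (F \<circ> prod.swap) (prod.swap p))"
  by (auto simp: pd1_def pd2_def fun_eq_iff)

lemma continuous_on_pd1:
  assumes "open A" "open B" and cont: "continuous_on (A \<times> B) F"
    and hol: "\<And>y. y \<in> B \<Longrightarrow> (\<lambda>x. F (x, y)) holomorphic_on A"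
  shows "continuous_on (A \<times> B) (pd1 F)"
proof -
  have swap: "continuous_on S (prod.swap :: complex \<times> complex \<Rightarrow> _)" for S
    by (intro continuous_intros continuous_on_swap)
  have "continuous_on (B \<times> A) (F \<circ> prod.swap)"
    using cont by (intro continuous_on_compose swap) (simp add: product_swap)
  then have "continuous_on (B \<times> A) (pd2 (F \<circ> prod.swap))"
    using assms by (intro continuous_on_pd2) auto
  then show ?thesis
    unfolding pd1_conv_pd2 by (rule continuous_on_compose2[OF _ swap]) auto
qed

text \<open>Differentiating the Cauchy integral for \<open>pd2 F\<close> under the integral sign in
  \<open>x\<close>. This makes \<open>pd1 (pd2 f)\<close> in \<open>P_op\<close> a genuine
  derivative and, through \<open>continuous_on_pd1\<close>, a continuous one.\<close>

lemma pd2_fst_holomorphic: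
  assumes "open A" "open B" and cont: "continuous_on (A \<times> B) F"
    and hol1: "\<And>y. y \<in> B \<Longrightarrow> (\<lambda>x. F (x, y)) holomorphic_on A"
    and hol2: "\<And>x. x \<in> A \<Longrightarrow> (\<lambda>y. F (x, y)) holomorphic_on B"
    and "y \<in> B"
  shows "(\<lambda>x. pd2 F (x, y)) holomorphic_on A"
proof -
  obtain r where r: "0 < r" "cball y r \<subseteq> B"
    using \<open>y \<in> B\<close> \<open>open B\<close> open_contains_cball by blast
  have sub: "w \<in> B" if "w \<in> sphere y r" for w using that r by auto
  have "(\<lambda>x. contour_integral (circlepath y r) (\<lambda>w. F (x, w) / (w - y)\<^sup>2)) holomorphic_on A"
    unfolding holomorphic_on_open[OF \<open>open A\<close>]
  proof (intro ballI exI, rule has_field_derivative_contour_integral_circlepath[OF \<open>open A\<close>])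
    show "((\<lambda>x. F (x, w) / (w - y)\<^sup>2) has_field_derivative pd1 F (x, w) / (w - y)\<^sup>2) (at x)"
      if "x \<in> A" "w \<in> sphere y r" for x w
      using pd1_has_field_derivative[OF \<open>open A\<close> that(1) hol1[OF sub[OF that(2)]]]
      by (rule DERIV_cdivide)
    show "continuous_on (sphere y r) (\<lambda>w. F (x, w) / (w - y)\<^sup>2)" if "x \<in> A" for x
      using r(1) sub that
      by (intro continuous_intros continuous_on_compose2[OF cont]) auto
    have "continuous_on (A \<times> sphere y r) (pd1 F)"
      by (rule continuous_on_subset[OF continuous_on_pd1[OF assms(1-3) hol1]]) (use sub in auto)
    then show "continuous_on (A \<times> sphere y r) (\<lambda>(x, w). pd1 F (x, w) / (w - y)\<^sup>2)"
      unfolding split_beta prod.collapse by (intro continuous_intros) (use r(1) in auto)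
  qed (use r(1) in auto)
  then have "(\<lambda>x. 1 / (2 * of_real pi * \<i>) *
      contour_integral (circlepath y r) (\<lambda>w. F (x, w) / (w - y)\<^sup>2)) holomorphic_on A"
    by (intro holomorphic_intros)
  then show ?thesis
    by (rule holomorphic_transform)
      (use r pd2_eq_contour_integral[OF hol2 r(2)] in auto)
qed

section \<open>Integrals over a product of two circles\<close>

definition torus_integral :: "complex \<Rightarrow> real \<Rightarrow> (complex \<Rightarrow> complex \<Rightarrow> complex) \<Rightarrow> complex" where
  "torus_integral z r G =
     contour_integral (circlepath z r) (\<lambda>x. contour_integral (circlepath z r) (G x))"

lemma torus_integral_cong:
  assumes "0 \<le> r" "\<And>x y. x \<in> sphere z r \<Longrightarrow> y \<in> sphere z r \<Longrightarrow> G x y = H x y"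
  shows "torus_integral z r G = torus_integral z r H"
  unfolding torus_integral_def using assms by (intro contour_integral_eq) auto

lemma continuous_on_slice:
  assumes "continuous_on (U \<times> S) (\<lambda>(x, y). G x y)" "x \<in> U"
  shows "continuous_on S (G x)"
proof -
  have "continuous_on S (\<lambda>y. (\<lambda>(x, y). G x y) (x, y))"
    by (rule continuous_on_compose2[OF assms(1)]) (use assms(2) in \<open>auto intro!: continuous_intros\<close>)
  then show ?thesis by simp
qed

lemma torus_integral_add:
  assumes "0 \<le> r"
    and G: "continuous_on (sphere z r \<times> sphere z r) (\<lambda>(x, y). G x y)"
    and H: "continuous_on (sphere z r \<times> sphere z r) (\<lambda>(x, y). H x y)"
  shows "torus_integral z r (\<lambda>x y. G x y + H x y) = torus_integral z r G + torus_integral z r H"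
proof -
  have "contour_integral (circlepath z r) (\<lambda>y. G x y + H x y) =
        contour_integral (circlepath z r) (G x) + contour_integral (circlepath z r) (H x)"
    if "x \<in> sphere z r" for x
    using that assms
    by (intro contour_integral_add contour_integrable_continuous_circlepath)
      (auto intro!: continuous_on_slice[where G = G] continuous_on_slice[where G = H])
  then have "torus_integral z r (\<lambda>x y. G x y + H x y) = contour_integral (circlepath z r)
      (\<lambda>x. contour_integral (circlepath z r) (G x) + contour_integral (circlepath z r) (H x))"
    unfolding torus_integral_def using assms(1) by (intro contour_integral_eq) auto
  also have "\<dots> = torus_integral z r G + torus_integral z r H"
    unfolding torus_integral_def using assms
    by (intro contour_integral_add contour_integrable_continuous_circlepath
        continuous_on_contour_integral_circlepath) auto
  finally show ?thesis .
qed

lemma torus_integral_cmult: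
  assumes "0 \<le> r" and G: "continuous_on (sphere z r \<times> sphere z r) (\<lambda>(x, y). G x y)"
  shows "torus_integral z r (\<lambda>x y. c * G x y) = c * torus_integral z r G"
proof -
  have "contour_integral (circlepath z r) (\<lambda>y. c * G x y) = c * contour_integral (circlepath z r) (G x)"
    if "x \<in> sphere z r" for x
    using that assms
    by (intro contour_integral_lmul contour_integrable_continuous_circlepath)
      (auto intro!: continuous_on_slice[where G = G])
  then have "torus_integral z r (\<lambda>x y. c * G x y) = contour_integral (circlepath z r)
      (\<lambda>x. c * contour_integral (circlepath z r) (G x))"
    unfolding torus_integral_def using assms(1) by (intro contour_integral_eq) auto
  also have "\<dots> = c * torus_integral z r G"
    unfolding torus_integral_def using assms
    by (intro contour_integral_lmul contour_integrable_continuous_circlepath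
        continuous_on_contour_integral_circlepath) auto
  finally show ?thesis .
qed

text \<open>Fubini for continuous integrands. The radii may differ because the two circles are later
  moved one after the other.\<close>

lemma contour_integral_circlepath_swap:
  assumes "0 \<le> r" "0 \<le> s"
    and "continuous_on (sphere z r \<times> sphere z s) (\<lambda>(x, y). G x y)"
  shows "contour_integral (circlepath z r) (\<lambda>x. contour_integral (circlepath z s) (G x)) =
    contour_integral (circlepath z s) (\<lambda>y. contour_integral (circlepath z r) (\<lambda>x. G x y))"
  using assms
  by (intro contour_integral_swap)
    (auto simp: vector_derivative_circlepath intro!: continuous_intros)

text \<open>For each fixed \<open>x\<close> the inner integrand has a primitive along a closed path,
  so already the inner integral vanishes.\<close>

lemma torus_integral_deriv_snd:
  assumes "0 \<le> r"
    and "\<And>x y. x \<in> sphere z r \<Longrightarrow> y \<in> sphere z r \<Longrightarrow> (G x has_field_derivative G' x y) (at y)"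
  shows "torus_integral z r G' = 0"
proof -
  have "contour_integral (circlepath z r) (G' x) = 0" if "x \<in> sphere z r" for x
  proof (rule contour_integral_unique)
    show "(G' x has_contour_integral 0) (circlepath z r)"
      using contour_integral_primitive[of "sphere z r" "G x" "G' x" "circlepath z r"]
        assms that by (auto intro: has_field_derivative_at_within)
  qed
  then have "torus_integral z r G' = contour_integral (circlepath z r) (\<lambda>x. 0)"
    unfolding torus_integral_def using assms(1) by (intro contour_integral_eq) auto
  then show ?thesis by simp
qed

text \<open>Here the primitive is in the outer variable; continuity of \<open>G'\<close> permits
  exchanging the integrals, which reduces to the previous case.\<close>

lemma torus_integral_deriv_fst:
  assumes "0 \<le> r"
    and "\<And>x y. x \<in> sphere z r \<Longrightarrow> y \<in> sphere z r \<Longrightarrow> ((\<lambda>x. G x y) has_field_derivative G' x y) (at x)"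
    and "continuous_on (sphere z r \<times> sphere z r) (\<lambda>(x, y). G' x y)"
  shows "torus_integral z r G' = 0"
proof -
  have "torus_integral z r G' = torus_integral z r (\<lambda>y x. G' x y)"
    unfolding torus_integral_def by (intro contour_integral_circlepath_swap assms)
  also have "\<dots> = 0"
    by (rule torus_integral_deriv_snd[of r z "\<lambda>y x. G x y"]) (use assms in auto)
  finally show ?thesis .
qed

text \<open>The one-circle rule is used twice: for the inner integral it supplies the derivative
  that the outer application needs.\<close>

lemma has_field_derivative_torus_integral:
  assumes "open U" "u \<in> U" "0 \<le> r"
    and der: "\<And>u x y. u \<in> U \<Longrightarrow> x \<in> sphere z r \<Longrightarrow> y \<in> sphere z r \<Longrightarrow>
                ((\<lambda>u. G u x y) has_field_derivative G' u x y) (at u)"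
    and cont: "continuous_on (U \<times> sphere z r \<times> sphere z r) (\<lambda>(u, x, y). G u x y)"
    and cont': "continuous_on (U \<times> sphere z r \<times> sphere z r) (\<lambda>(u, x, y). G' u x y)"
  shows "((\<lambda>u. torus_integral z r (G u)) has_field_derivative torus_integral z r (G' u)) (at u)"
  unfolding torus_integral_def
proof (rule has_field_derivative_contour_integral_circlepath[OF assms(1-3)])
  \<comment> \<open>Regrouping the triple as \<open>((u, x), y)\<close> makes \<open>(u, x)\<close>
    the parameter of the inner integral.\<close>
  have assoc: "continuous_on ((U \<times> sphere z r) \<times> sphere z r) (\<lambda>(p, y). H (fst p) (snd p) y)"
    if "continuous_on (U \<times> sphere z r \<times> sphere z r) (\<lambda>(u, x, y). H u x y)"
    for H :: "complex \<Rightarrow> complex \<Rightarrow> complex \<Rightarrow> complex"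
  proof -
    have "continuous_on ((U \<times> sphere z r) \<times> sphere z r)
        (\<lambda>q. (\<lambda>(u, x, y). H u x y) (fst (fst q), snd (fst q), snd q))"
      by (rule continuous_on_compose2[OF that]) (auto intro!: continuous_intros)
    then show ?thesis by (simp add: split_beta)
  qed
  have inner: "continuous_on (U \<times> sphere z r) (\<lambda>(u, x). contour_integral (circlepath z r) (H u x))"
    if "continuous_on (U \<times> sphere z r \<times> sphere z r) (\<lambda>(u, x, y). H u x y)"
    for H :: "complex \<Rightarrow> complex \<Rightarrow> complex \<Rightarrow> complex"
    using continuous_on_contour_integral_circlepath[OF assoc[OF that] assms(3)]
    by (simp add: split_beta)
  show "continuous_on (U \<times> sphere z r) (\<lambda>(u, x). contour_integral (circlepath z r) (G' u x))"
    by (rule inner[OF cont'])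
  show "continuous_on (sphere z r) (\<lambda>x. contour_integral (circlepath z r) (G u x))" if "u \<in> U" for u
    using continuous_on_slice[OF inner[OF cont] that] .
  show "((\<lambda>u. contour_integral (circlepath z r) (G u x)) has_field_derivative
          contour_integral (circlepath z r) (G' v x)) (at v)" if "v \<in> U" "x \<in> sphere z r" for v x
  proof (rule has_field_derivative_contour_integral_circlepath[OF assms(1) that(1) assms(3)])
    show "continuous_on (sphere z r) (G w x)" if "w \<in> U" for w
      using continuous_on_slice[OF assoc[OF cont], of "(w, x)"] that \<open>x \<in> sphere z r\<close> by simp
    have "continuous_on (U \<times> sphere z r) (\<lambda>q. (\<lambda>(u, x, y). G' u x y) (fst q, x, snd q))"
      by (rule continuous_on_compose2[OF cont']) (use that in \<open>auto intro!: continuous_intros\<close>)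
    then show "continuous_on (U \<times> sphere z r) (\<lambda>(u, y). G' u x y)"
      by (simp add: split_beta)
  qed (use der that in auto)
qed

section \<open>The operator \<open>T\<close>\<close>

text \<open>A closed ball is connected. If it left \<open>D\<close> while containing
  \<open>z \<in> D\<close>, it would meet the frontier at distance at most \<open>r\<close> from
  \<open>z\<close>.\<close>

lemma cball_subset_of_bdry_dist:
  assumes "z \<in> D" "ereal r < bdry_dist D z"
  shows "cball z r \<subseteq> D"
proof (rule ccontr)
  assume "\<not> cball z r \<subseteq> D"
  then obtain w where w: "w \<in> cball z r" "w \<notin> D" by blast
  \<comment> \<open>The sign of \<open>r\<close> is not given; that the ball has a point
    \<open>w\<close> forces \<open>0 \<le> r\<close>.\<close>
  then have "z \<in> cball z r" using order_trans[OF zero_le_dist[of z w], of r] by simp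
  with w have "cball z r \<inter> frontier D \<noteq> {}"
    using assms(1) by (intro connected_Int_frontier) blast+
  then obtain v where v: "v \<in> frontier D" "dist z v \<le> r" by auto
  have "bdry_dist D z \<le> ereal (dist z v)"
    unfolding bdry_dist_def using v(1) by (rule INF_lower)
  also have "\<dots> \<le> ereal r" using v(2) by simp
  finally show False using assms(2) by simp
qed

text \<open>At a zero, \<open>|a| |b| = |t| |a - b| \<le> |t| |a| + |t| |b|\<close>, yet each
  summand on the right is less than half of \<open>|a| |b|\<close>. Allowing \<open>|a|\<close> and
  \<open>|b|\<close> to differ is what lets the two circles be moved separately.\<close>

lemma kernel_nonzero:
  fixes a b t :: complex
  assumes "2 * cmod t < cmod a" "2 * cmod t < cmod b"
  shows "a * b + t * (a - b) \<noteq> 0"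
proof
  assume "a * b + t * (a - b) = 0"
  then have "a * b = - (t * (a - b))" by (simp add: eq_neg_iff_add_eq_0)
  then have "cmod a * cmod b = cmod t * cmod (a - b)"
    by (metis norm_minus_cancel norm_mult)
  also have "\<dots> \<le> cmod t * cmod a + cmod t * cmod b"
    using mult_left_mono[OF norm_triangle_ineq4[of a b], of "cmod t"] by (simp add: distrib_left)
  finally have "cmod a * cmod b \<le> cmod t * cmod a + cmod t * cmod b" .
  moreover have pos: "0 < cmod a" "0 < cmod b"
    using assms norm_ge_zero[of t] by linarith+
  have "2 * cmod t * cmod a < cmod b * cmod a" "2 * cmod t * cmod b < cmod a * cmod b"
    using assms pos by (auto intro: mult_strict_right_mono)
  ultimately show False by (simp add: mult.commute)
qed

text \<open>Points of equal angle on the two circles are joined by radial segments, which stay in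
  the closed annulus; this linear homotopy lies in \<open>S\<close>, and Cauchy's theorem
  applies.\<close>

lemma contour_integral_circlepath_radius:
  assumes "open S" "g holomorphic_on S" "0 \<le> r" "0 \<le> s"
    and sub: "\<And>w. min r s \<le> dist z w \<Longrightarrow> dist z w \<le> max r s \<Longrightarrow> w \<in> S"
  shows "contour_integral (circlepath z r) g = contour_integral (circlepath z s) g"
proof (rule Cauchy_theorem_homotopic_loops[OF _ assms(1,2)])
  show "homotopic_loops S (circlepath z r) (circlepath z s)"
  proof (rule homotopic_loops_linear)
    fix \<theta> :: real
    show "closed_segment (circlepath z r \<theta>) (circlepath z s \<theta>) \<subseteq> S"
    proof
      fix w assume "w \<in> closed_segment (circlepath z r \<theta>) (circlepath z s \<theta>)"
      then obtain u where u: "0 \<le> u" "u \<le> 1"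
        and w: "w = (1 - u) *\<^sub>R circlepath z r \<theta> + u *\<^sub>R circlepath z s \<theta>"
        unfolding in_segment by blast
      define \<rho> where "\<rho> = (1 - u) * r + u * s"
      have "w - z = of_real \<rho> * exp (2 * of_real pi * \<i> * \<theta>)"
        unfolding w \<rho>_def circlepath by (simp add: scaleR_conv_of_real algebra_simps)
      moreover have "cmod (exp (2 * of_real pi * \<i> * \<theta>)) = 1"
        using norm_exp_i_times[of "2 * pi * \<theta>"] by (simp add: mult_ac)
      moreover have "0 \<le> \<rho>" using u assms(3,4) by (simp add: \<rho>_def)
      ultimately have "dist z w = \<rho>" by (simp add: dist_norm norm_minus_commute norm_mult)
      \<comment> \<open>The lower bound is the upper bound for convex combinations, applied to the
        negated radii.\<close>
      moreover have "min r s \<le> \<rho>" "\<rho> \<le> max r s"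
        using convex_bound_le[of "- r" "- min r s" "- s" "1 - u" u]
          convex_bound_le[of r "max r s" s "1 - u" u] u
        by (auto simp: \<rho>_def)
      ultimately show "w \<in> S" using sub by simp
    qed
  qed auto
qed auto

text \<open>The inner circle is moved with \<open>x\<close> fixed, the integrals are exchanged, the
  other circle is moved with \<open>y\<close> fixed, and the integrals are exchanged back.\<close>

lemma T_circ_radius:
  assumes "open D" and cont: "continuous_on (D \<times> D) f"
    and hol1: "\<And>y. y \<in> D \<Longrightarrow> (\<lambda>x. f (x, y)) holomorphic_on D"
    and hol2: "\<And>x. x \<in> D \<Longrightarrow> (\<lambda>y. f (x, y)) holomorphic_on D"
    and r: "2 * cmod t < r" "cball z r \<subseteq> D" and s: "2 * cmod t < s" "cball z s \<subseteq> D"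
  shows "T_circ f r (z, t) = T_circ f s (z, t)"
proof -
  \<comment> \<open>Without the closed disc of radius \<open>2|t|\<close> the denominator has no
    zero on \<open>S \<times> S\<close>, and \<open>S\<close> still contains the closed annulus
    between the circles.\<close>
  define S where "S = D - cball z (2 * cmod t)"
  define g where "g = (\<lambda>x y. f (x, y) / ((x - z) * (y - z) + t * (x - y)))"
  have pos: "0 \<le> r" "0 \<le> s" using r(1) s(1) norm_ge_zero[of t] by linarith+
  have "open S" unfolding S_def using \<open>open D\<close> by (simp add: open_Diff)
  have nz: "(x - z) * (y - z) + t * (x - y) \<noteq> 0" if "x \<in> S" "y \<in> S" for x y
    using kernel_nonzero[of t "x - z" "y - z"] that
    by (simp add: S_def dist_norm norm_minus_commute)
  have S: "w \<in> S" if "min r s \<le> dist z w" "dist z w \<le> max r s" for w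
  proof -
    have "w \<in> cball z r \<or> w \<in> cball z s" using that(2) by (auto simp: max_def split: if_splits)
    moreover have "2 * cmod t < dist z w" using that(1) r(1) s(1) by (auto simp: min_def split: if_splits)
    ultimately show ?thesis using r(2) s(2) by (auto simp: S_def)
  qed
  have shift2: "contour_integral (circlepath z r) (g x) = contour_integral (circlepath z s) (g x)"
    if "x \<in> S" for x
  proof (rule contour_integral_circlepath_radius[OF \<open>open S\<close> _ pos S])
    have "(\<lambda>y. f (x, y)) holomorphic_on S"
      using hol2[of x] that by (auto simp: S_def intro: holomorphic_on_subset)
    then show "g x holomorphic_on S"
      unfolding g_def using nz[OF that] by (intro holomorphic_intros) auto
  qed
  have shift1: "contour_integral (circlepath z r) (\<lambda>x. g x y) = contour_integral (circlepath z s) (\<lambda>x. g x y)"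
    if "y \<in> S" for y
  proof (rule contour_integral_circlepath_radius[OF \<open>open S\<close> _ pos S])
    have "(\<lambda>x. f (x, y)) holomorphic_on S"
      using hol1[of y] that by (auto simp: S_def intro: holomorphic_on_subset)
    then show "(\<lambda>x. g x y) holomorphic_on S"
      unfolding g_def using nz[OF _ that] by (intro holomorphic_intros) auto
  qed
  have sph: "sphere z r \<subseteq> S" "sphere z s \<subseteq> S"
    using r s by (auto simp: S_def)
  have "continuous_on (S \<times> S) (\<lambda>(x, y). g x y)"
    unfolding g_def split_beta prod.collapse
    using nz by (intro continuous_intros continuous_on_subset[OF cont]) (auto simp: S_def)
  then have cont_g: "continuous_on (A \<times> B) (\<lambda>(x, y). g x y)" if "A \<subseteq> S" "B \<subseteq> S" for A B
    by (rule continuous_on_subset) (use that in auto)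
  have "torus_integral z r g = contour_integral (circlepath z r) (\<lambda>x. contour_integral (circlepath z s) (g x))"
    unfolding torus_integral_def using shift2 sph(1) pos by (intro contour_integral_eq) auto
  also have "\<dots> = contour_integral (circlepath z s) (\<lambda>y. contour_integral (circlepath z r) (\<lambda>x. g x y))"
    by (intro contour_integral_circlepath_swap pos cont_g sph)
  also have "\<dots> = contour_integral (circlepath z s) (\<lambda>y. contour_integral (circlepath z s) (\<lambda>x. g x y))"
    using shift1 sph(2) pos by (intro contour_integral_eq) auto
  also have "\<dots> = torus_integral z s g"
    unfolding torus_integral_def by (intro contour_integral_circlepath_swap[symmetric] pos cont_g sph)
  finally show ?thesis
    by (simp add: T_circ_def torus_integral_def g_def)
qed

text \<open>
  Here \<open>k\<close>, \<open>d\<close>, \<open>p\<close>, \<open>q\<close> stand for the kernel \<open>1/Q\<close>, for \<open>x - y\<close>, and for the \<open>x\<close>- and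
  \<open>y\<close>-derivatives of \<open>Q\<close>; the two brackets are the derivatives of
  \<open>A = d\<^sup>2 k f\<^sub>y - d k f\<close> and \<open>B = d k f - (d\<^sup>2 k)\<^sub>x f\<close>.
\<close>
lemma kernel_divergence_identity:
  fixes d k p q t Q F Fx Fy Fxy :: "'a::field"
  assumes "Q * k = 1" "p * q = Q - t\<^sup>2" "q - p = d - 2 * t"
  shows "(d\<^sup>2 * Fxy - d * (Fx - Fy)) * k =
    ((2 * d * k - d\<^sup>2 * p * k\<^sup>2) * Fy + d\<^sup>2 * k * Fxy - (k - d * p * k\<^sup>2) * F - d * k * Fx)
    + ((- k - d * q * k\<^sup>2) * F + d * k * Fy
       - (- 2 * k - 2 * d * q * k\<^sup>2 + 2 * d * p * k\<^sup>2 - d\<^sup>2 * k\<^sup>2 + 2 * d\<^sup>2 * p * q * k ^ 3) * F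
       - (2 * d * k - d\<^sup>2 * p * k\<^sup>2) * Fy)
    + (2 * t * (F * d * k\<^sup>2) - t\<^sup>2 * (2 * (F * d\<^sup>2 * k ^ 3)))"
proof -
  have 1: "p * q * k ^ 3 = k\<^sup>2 - t\<^sup>2 * k ^ 3"
  proof -
    have "p * q * k ^ 3 = (Q * k) * k\<^sup>2 - t\<^sup>2 * k ^ 3"
      unfolding assms(2) by (simp add: power3_eq_cube power2_eq_square algebra_simps)
    then show ?thesis using assms(1) by simp
  qed
  have 2: "q = p + d - 2 * t" using assms(3) by (simp add: algebra_simps)
  have 3: "2 * d\<^sup>2 * p * q * k ^ 3 = 2 * d\<^sup>2 * (k\<^sup>2 - t\<^sup>2 * k ^ 3)"
    using 1 by (simp add: mult.assoc)
  \<comment> \<open>The product \<open>p * q\<close> must be replaced before \<open>q\<close> is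
    eliminated, which would break it up. What remains is a polynomial identity.\<close>
  show ?thesis unfolding 3 unfolding 2
    by (simp add: power2_eq_square algebra_simps)
qed

theorem theorem3p1:
  fixes D :: "complex set" and f :: "complex \<times> complex \<Rightarrow> complex"
  assumes "open D"
    and "f holomorphic2_on (D \<times> D)"
  shows "\<forall>(z, t) \<in> U_dom D.
           T_op D (P_op f) (z, t) =
           - euler_t (\<lambda>p. euler_t (T_op D f) p + T_op D f p) (z, t)"
proof (clarify)
  fix z t assume "(z, t) \<in> U_dom D"
  then have zD: "z \<in> D" and "ereal (2 * cmod t) < bdry_dist D z"
    by (auto simp: U_dom_def)
  note cont = holomorphic2_on_imp_continuous_on[OF assms(2)]
  note hol1 = holomorphic2_on_imp_fst_holomorphic[OF assms(2)]
  note hol2 = holomorphic2_on_imp_snd_holomorphic[OF assms(2)]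
  have cont1: "continuous_on (D \<times> D) (pd1 f)"
    by (rule continuous_on_pd1[OF assms(1,1) cont hol1])
  have cont2: "continuous_on (D \<times> D) (pd2 f)"
    by (rule continuous_on_pd2[OF assms(1,1) cont hol2])
  have hol21: "(\<lambda>x. pd2 f (x, y)) holomorphic_on D" if "y \<in> D" for y
    by (rule pd2_fst_holomorphic[OF assms(1,1) cont hol1 hol2 that])
  have cont21: "continuous_on (D \<times> D) (pd1 (pd2 f))"
    by (rule continuous_on_pd1[OF assms(1,1) cont2 hol21])

  \<comment> \<open>One radius for all parameters near \<open>t\<close>\<close>
  define adm where "adm u \<rho> \<longleftrightarrow> 2 * cmod u < \<rho> \<and> ereal \<rho> < bdry_dist D z" for u \<rho>
  have "\<exists>\<rho>. adm t \<rho>"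
    using ereal_dense2[OF \<open>ereal (2 * cmod t) < bdry_dist D z\<close>] by (auto simp: adm_def)
  \<comment> \<open>This is the very radius that \<open>T_op\<close> selects at
    \<open>(z, t)\<close>. Hence at this point \<open>T_op D (P_op f)\<close> is
    \<open>T_circ (P_op f) r\<close> by definition, and independence of the radius is invoked for
    \<open>f\<close> only.\<close>
  define r where "r = (SOME \<rho>. adm t \<rho>)"
  have "adm t r" unfolding r_def using \<open>\<exists>\<rho>. adm t \<rho>\<close> by (rule someI_ex)
  then have r: "2 * cmod t < r" "cball z r \<subseteq> D"
    using cball_subset_of_bdry_dist[OF zD] by (auto simp: adm_def)
  have r0: "0 \<le> r" using r(1) norm_ge_zero[of t] by linarith
  \<comment> \<open>The disc of those \<open>u\<close> for which \<open>r\<close> stays admissible: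
    a neighbourhood of \<open>t\<close> on which \<open>T f (z, u)\<close> can be computed with the
    single radius \<open>r\<close>.\<close>
  define U where "U = ball (0::complex) (r / 2)"
  define c where "c = 1 / (2 * of_real pi * \<i>)\<^sup>2"
  define K where "K u x y = inverse ((x - z) * (y - z) + u * (x - y))" for u x y
  let ?S = "sphere z r"
  have U: "open U" "t \<in> U" and U_iff: "u \<in> U \<longleftrightarrow> 2 * cmod u < r" for u
    using r(1) by (auto simp: U_def)
  have sD: "?S \<subseteq> D" using r(2) by auto
  have T_op_eq: "T_op D f (z, u) = T_circ f r (z, u)" if "u \<in> U" for u
  proof -
    have "adm u r" using \<open>adm t r\<close> that by (simp add: adm_def U_iff)
    then have "adm u (SOME \<rho>. adm u \<rho>)" by (rule someI)
    then have "2 * cmod u < (SOME \<rho>. adm u \<rho>)" "cball z (SOME \<rho>. adm u \<rho>) \<subseteq> D"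
      using cball_subset_of_bdry_dist[OF zD] by (simp_all add: adm_def)
    then have "T_circ f (SOME \<rho>. adm u \<rho>) (z, u) = T_circ f r (z, u)"
      using that r(2) by (intro T_circ_radius[OF assms(1) cont hol1 hol2]) (simp_all add: U_iff)
    then show ?thesis by (simp add: T_op_def adm_def)
  qed
  have nz: "(x - z) * (y - z) + u * (x - y) \<noteq> 0" if "u \<in> U" "x \<in> ?S" "y \<in> ?S" for u x y
    using kernel_nonzero[of u "x - z" "y - z"] that
    by (simp add: U_iff dist_norm norm_minus_commute)
  have T_circ_eq: "T_circ g r (z, u) = c * torus_integral z r (\<lambda>x y. g (x, y) * K u x y)" for g u
    by (simp add: T_circ_def c_def torus_integral_def K_def divide_inverse)

  have contS: "continuous_on (V \<times> ?S \<times> ?S) (\<lambda>(u, x, y). g (x, y))"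
    if "continuous_on (D \<times> D) g" for g :: "complex \<times> complex \<Rightarrow> complex" and V :: "complex set"
    unfolding split_beta prod.collapse
    by (rule continuous_on_compose2[OF that]) (use sD in \<open>auto intro!: continuous_intros\<close>)
  have contK: "continuous_on (U \<times> ?S \<times> ?S) (\<lambda>(u, x, y). K u x y)"
    unfolding K_def split_beta using nz by (intro continuous_intros) auto
  have derK: "((\<lambda>u. K u x y) has_field_derivative - (x - y) * (K u x y)\<^sup>2) (at u)"
    if "u \<in> U" "x \<in> ?S" "y \<in> ?S" for u x y
    unfolding K_def using nz[OF that]
    by (auto intro!: derivative_eq_intros simp: power2_eq_square algebra_simps)

  \<comment> \<open>Derivatives in \<open>t\<close> under the integral sign\<close>
  define J where "J u = torus_integral z r (\<lambda>x y. f (x, y) * K u x y)" for u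
  \<comment> \<open>\<open>J1\<close> and \<open>J2\<close> carry the first and second
    \<open>u\<close>-derivatives of the integrand of \<open>J\<close>, obtained from
    \<open>dK/du = -(x - y) K^2\<close>.\<close>
  define J1 where "J1 u = torus_integral z r (\<lambda>x y. - (f (x, y) * (x - y) * (K u x y)\<^sup>2))" for u
  define J2 where "J2 u = torus_integral z r (\<lambda>x y. 2 * (f (x, y) * (x - y)\<^sup>2 * K u x y ^ 3))" for u
  note cts = contS[OF cont, unfolded split_beta] contK[unfolded split_beta]
  have J: "(J has_field_derivative J1 u) (at u)" if "u \<in> U" for u
    unfolding J_def J1_def
  proof (rule has_field_derivative_torus_integral[OF U(1) that r0])
    show "((\<lambda>u. f (x, y) * K u x y) has_field_derivative - (f (x, y) * (x - y) * (K u x y)\<^sup>2)) (at u)"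
      if "u \<in> U" "x \<in> ?S" "y \<in> ?S" for u x y
      by (rule DERIV_cong[OF DERIV_cmult[OF derK[OF that]]]) (simp add: algebra_simps)
  qed (unfold split_beta, (intro continuous_intros cts)+)
  have J1: "(J1 has_field_derivative J2 u) (at u)" if "u \<in> U" for u
    unfolding J1_def J2_def
  proof (rule has_field_derivative_torus_integral[OF U(1) that r0])
    show "((\<lambda>u. - (f (x, y) * (x - y) * (K u x y)\<^sup>2)) has_field_derivative
            2 * (f (x, y) * (x - y)\<^sup>2 * K u x y ^ 3)) (at u)"
      if "u \<in> U" "x \<in> ?S" "y \<in> ?S" for u x y
      by (rule DERIV_cong[OF DERIV_minus[OF DERIV_cmult[OF DERIV_power[OF derK[OF that]]]]])
        (simp add: algebra_simps power2_eq_square power3_eq_cube)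
  qed (unfold split_beta, (intro continuous_intros cts)+)

  have T_op_J: "T_op D f (z, u) = c * J u" if "u \<in> U" for u
    using T_op_eq[OF that] T_circ_eq by (simp add: J_def)
  have pd2_T: "pd2 (T_op D f) (z, u) = c * J1 u" if "u \<in> U" for u
  proof -
    have "((\<lambda>w. T_op D f (z, w)) has_field_derivative c * J1 u) (at u)"
      by (rule has_field_derivative_transform_within_open[OF DERIV_cmult[OF J[OF that]] U(1) that])
        (simp add: T_op_J)
    then show ?thesis by (simp add: pd2_def DERIV_imp_deriv)
  qed
  \<comment> \<open>With \<open>F = c J\<close>,
    \<open>t d/dt (t d/dt + 1) F = t (t F' + F)' = t (2 F' + t F'')\<close>.\<close>
  have "((\<lambda>u. u * (c * J1 u) + c * J u) has_field_derivative c * (2 * J1 t + t * J2 t)) (at t)"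
    by (rule derivative_eq_intros J[OF U(2)] J1[OF U(2)] refl)+ (simp add: algebra_simps)
  then have "((\<lambda>u. euler_t (T_op D f) (z, u) + T_op D f (z, u)) has_field_derivative
      c * (2 * J1 t + t * J2 t)) (at t)"
    by (rule has_field_derivative_transform_within_open[OF _ U])
      (simp add: euler_t_def pd2_T T_op_J)
  then have pd2_euler: "pd2 (\<lambda>p. euler_t (T_op D f) p + T_op D f p) (z, t) = c * (2 * J1 t + t * J2 t)"
    unfolding pd2_def by (simp add: DERIV_imp_deriv)
  have rhs: "euler_t (\<lambda>p. euler_t (T_op D f) p + T_op D f p) (z, t) = c * (2 * t * J1 t + t\<^sup>2 * J2 t)"
    unfolding euler_t_def[of "\<lambda>p. euler_t (T_op D f) p + T_op D f p"] prod.case pd2_euler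
    by (simp add: algebra_simps power2_eq_square)

  \<comment> \<open>Integration by parts on the torus\<close>
  define k where "k x y = K t x y" for x y
  \<comment> \<open>\<open>p\<close> and \<open>q\<close> are the \<open>x\<close>- and
    \<open>y\<close>-derivatives of the denominator.\<close>
  define p where "p y = y - z + t" for y
  define q where "q x = x - z - t" for x
  have contk: "continuous_on (?S \<times> ?S) (\<lambda>p. k (fst p) (snd p))"
    unfolding k_def K_def using nz[OF U(2)] by (intro continuous_intros) auto
  have subS: "continuous_on (?S \<times> ?S) (\<lambda>p. g (fst p, snd p))" if "continuous_on (D \<times> D) g"
    for g :: "complex \<times> complex \<Rightarrow> complex"
    using continuous_on_subset[OF that, of "?S \<times> ?S"] sD by auto
  note ctsS = subS[OF cont] subS[OF cont1] subS[OF cont2] subS[OF cont21] contk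
  \<comment> \<open>The second-order term of \<open>P_op\<close> is integrated by parts in
    \<open>x\<close> and then in \<open>y\<close>, each first-order term once in its own variable.
    \<open>Ax\<close> and \<open>By\<close> are the resulting total derivatives, expanded; their
    primitives appear in the proofs of \<open>A0\<close> and \<open>B0\<close>.\<close>
  define Ax where "Ax x y = (2 * (x - y) * k x y - (x - y)\<^sup>2 * p y * (k x y)\<^sup>2) * pd2 f (x, y)
      + (x - y)\<^sup>2 * k x y * pd1 (pd2 f) (x, y)
      - (k x y - (x - y) * p y * (k x y)\<^sup>2) * f (x, y) - (x - y) * k x y * pd1 f (x, y)" for x y
  define By where "By x y = (- k x y - (x - y) * q x * (k x y)\<^sup>2) * f (x, y) + (x - y) * k x y * pd2 f (x, y)
      - (- 2 * k x y - 2 * (x - y) * q x * (k x y)\<^sup>2 + 2 * (x - y) * p y * (k x y)\<^sup>2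
         - (x - y)\<^sup>2 * (k x y)\<^sup>2 + 2 * (x - y)\<^sup>2 * p y * q x * k x y ^ 3) * f (x, y)
      - (2 * (x - y) * k x y - (x - y)\<^sup>2 * p y * (k x y)\<^sup>2) * pd2 f (x, y)" for x y
  have derkx: "((\<lambda>x. k x y) has_field_derivative - p y * (k x y)\<^sup>2) (at x)"
    if "x \<in> ?S" "y \<in> ?S" for x y
    unfolding k_def K_def p_def using nz[OF U(2) that]
    by (auto intro!: derivative_eq_intros simp: power2_eq_square algebra_simps)
  have derky: "((\<lambda>y. k x y) has_field_derivative - q x * (k x y)\<^sup>2) (at y)"
    if "x \<in> ?S" "y \<in> ?S" for x y
    unfolding k_def K_def q_def using nz[OF U(2) that]
    by (auto intro!: derivative_eq_intros simp: power2_eq_square algebra_simps)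
  have contA: "continuous_on (?S \<times> ?S) (\<lambda>(x, y). Ax x y)"
    unfolding Ax_def split_beta p_def by (intro continuous_intros ctsS)
  have contB: "continuous_on (?S \<times> ?S) (\<lambda>(x, y). By x y)"
    unfolding By_def split_beta p_def q_def by (intro continuous_intros ctsS)
  have A0: "torus_integral z r Ax = 0"
  proof (rule torus_integral_deriv_fst[OF r0 _ contA])
    fix x y assume xy: "x \<in> ?S" "y \<in> ?S"
    then have D: "x \<in> D" "y \<in> D" using sD by auto
    show "((\<lambda>x. (x - y)\<^sup>2 * k x y * pd2 f (x, y) - (x - y) * k x y * f (x, y))
        has_field_derivative Ax x y) (at x)"
      unfolding Ax_def
      by (rule derivative_eq_intros derkx[OF xy] refl
          pd1_has_field_derivative[OF assms(1) D(1) hol1[OF D(2)]]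
          pd1_has_field_derivative[OF assms(1) D(1) hol21[OF D(2)]])+
        (simp add: algebra_simps power2_eq_square)
  qed
  have B0: "torus_integral z r By = 0"
  proof (rule torus_integral_deriv_snd[OF r0])
    fix x y assume xy: "x \<in> ?S" "y \<in> ?S"
    then have D: "x \<in> D" "y \<in> D" using sD by auto
    show "((\<lambda>y. (x - y) * k x y * f (x, y)
          - (2 * (x - y) * k x y - (x - y)\<^sup>2 * p y * (k x y)\<^sup>2) * f (x, y))
        has_field_derivative By x y) (at y)"
      unfolding By_def p_def
      by (rule derivative_eq_intros derky[OF xy] refl
          pd2_has_field_derivative[OF assms(1) D(2) hol2[OF D(1)]])+
        (simp add: algebra_simps power2_eq_square power3_eq_cube)
  qed
  \<comment> \<open>As \<open>(x - z)(y - z) = Q - t(x - y)\<close>, the remaining term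
    \<open>2t(x - y)(x - z)(y - z) k^3 f\<close> equals
    \<open>2t(x - y) k^2 f - 2t^2 (x - y)^2 k^3 f\<close>: the integrands of \<open>J1\<close> and
    \<open>J2\<close> with weights \<open>-2t\<close> and \<open>-t^2\<close>.\<close>
  have split: "P_op f (x, y) * K t x y = (Ax x y + By x y)
      + (- 2 * t * - (f (x, y) * (x - y) * (K t x y)\<^sup>2)
         + - t\<^sup>2 * (2 * (f (x, y) * (x - y)\<^sup>2 * K t x y ^ 3)))" if "x \<in> ?S" "y \<in> ?S" for x y
  proof -
    have 1: "((x - z) * (y - z) + t * (x - y)) * k x y = 1"
      using nz[OF U(2) that] by (simp add: k_def K_def)
    have 2: "p y * q x = ((x - z) * (y - z) + t * (x - y)) - t\<^sup>2"
      by (simp add: p_def q_def algebra_simps power2_eq_square)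
    have 3: "q x - p y = (x - y) - 2 * t"
      by (simp add: p_def q_def)
    show ?thesis
      using kernel_divergence_identity[OF 1 2 3, where F = "f (x, y)" and Fx = "pd1 f (x, y)"
          and Fy = "pd2 f (x, y)" and Fxy = "pd1 (pd2 f) (x, y)"]
      by (simp add: P_op_def Ax_def By_def k_def)
  qed
  have contJ1: "continuous_on (?S \<times> ?S) (\<lambda>(x, y). - (f (x, y) * (x - y) * (K t x y)\<^sup>2))"
    unfolding k_def[symmetric] split_beta by (intro continuous_intros ctsS)
  have contJ2: "continuous_on (?S \<times> ?S) (\<lambda>(x, y). 2 * (f (x, y) * (x - y)\<^sup>2 * K t x y ^ 3))"
    unfolding k_def[symmetric] split_beta by (intro continuous_intros ctsS)
  note mult_cont = continuous_on_mult_left[OF contJ1[unfolded split_beta]]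
    continuous_on_mult_left[OF contJ2[unfolded split_beta]]
  have "torus_integral z r (\<lambda>x y. P_op f (x, y) * K t x y) = torus_integral z r (\<lambda>x y. (Ax x y + By x y)
      + (- 2 * t * - (f (x, y) * (x - y) * (K t x y)\<^sup>2)
         + - t\<^sup>2 * (2 * (f (x, y) * (x - y)\<^sup>2 * K t x y ^ 3))))"
    by (rule torus_integral_cong[OF r0 split])
  also have "\<dots> = - 2 * t * J1 t + - t\<^sup>2 * J2 t"
  proof -
    have s1: "torus_integral z r (\<lambda>x y. Ax x y + By x y) = 0"
      using torus_integral_add[OF r0 contA contB] A0 B0 by simp
    have s2: "torus_integral z r (\<lambda>x y. - 2 * t * - (f (x, y) * (x - y) * (K t x y)\<^sup>2)
         + - t\<^sup>2 * (2 * (f (x, y) * (x - y)\<^sup>2 * K t x y ^ 3))) = - 2 * t * J1 t + - t\<^sup>2 * J2 t"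
      unfolding J1_def J2_def torus_integral_cmult[OF r0 contJ1, symmetric]
        torus_integral_cmult[OF r0 contJ2, symmetric]
      by (rule torus_integral_add[OF r0]; unfold split_beta; rule mult_cont)
    have c1: "continuous_on (?S \<times> ?S) (\<lambda>(x, y). Ax x y + By x y)"
      using continuous_on_add[OF contA contB] by (simp add: split_beta)
    have c2: "continuous_on (?S \<times> ?S) (\<lambda>(x, y). - 2 * t * - (f (x, y) * (x - y) * (K t x y)\<^sup>2)
         + - t\<^sup>2 * (2 * (f (x, y) * (x - y)\<^sup>2 * K t x y ^ 3)))"
      unfolding split_beta by (rule continuous_on_add; rule mult_cont)
    show ?thesis
      unfolding torus_integral_add[OF r0 c1 c2] s1 s2 by simp
  qed
  finally have torus_P: "torus_integral z r (\<lambda>x y. P_op f (x, y) * K t x y) =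
      - 2 * t * J1 t + - t\<^sup>2 * J2 t" .
  have "T_circ (P_op f) r (z, t) = - (c * (2 * t * J1 t + t\<^sup>2 * J2 t))"
    unfolding T_circ_eq torus_P by (simp add: algebra_simps)
  moreover have "T_op D (P_op f) (z, t) = T_circ (P_op f) r (z, t)"
    by (simp add: T_op_def r_def adm_def)
  ultimately show "T_op D (P_op f) (z, t) =
      - euler_t (\<lambda>p. euler_t (T_op D f) p + T_op D f p) (z, t)"
    using rhs by simp
qed

end
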